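(* Let $P\subseteq\mathbb{R}^d$ be a rational $d$-polytope with codenominator $r$, and let $m\in\mathbb{Z}_{>0}$ be such that $\frac{m}{2r}P$ is a lattice polytope. Then $$\operatorname{Ehr}^{\mathsf{ref}}_{\mathbb{Q}}(P;t):=1+\sum_{n\in\mathbb{Z}_{>0}}\operatorname{ehr}_{\mathbb{Q}}\left(P;\tfrac{n}{2r}\right)t^{\frac{n}{2r}}=\frac{\operatorname{h}^{*\mathsf{ref}}_{\mathbb{Q}}(P;t;m)}{\left(1-t^{\frac{m}{2r}}\right)^{d+1}},$$ where $\operatorname{h}^{*\mathsf{ref}}_{\mathbb{Q}}(P;t;m)$ is a polynomial in $\mathbb{Z}[t^{\frac1{2r}}]$ with nonnegative coefficients.
   Context: A rational (resp. lattice) polytope is the convex hull of finitely many points of $\mathbb{Q}^d$ (resp. $\mathbb{Z}^d$); a $d$-polytope is a $d$-dimensional polytope in $\mathbb{R}^d$, $d\ge1$. Codenominator: write a rational $d$-polytope $P$ by its irredundant halfspace description $P=\{\mathbf{x}\in\mathbb{R}^d:\mathbf{A}\mathbf{x}\le\mathbf{b}\}$ with $\mathbf{A}\in\mathbb{Z}^{n\times d}$, $\mathbf{b}\in\mathbb{Z}^n$, such that for every $i$ the greatest common divisor of $b_i$ and the entries of the $i$th row of $\mathbf{A}$ is $1$; the codenominator of $P$ is the (positive) least common multiple $r$ of the nonzero entries of $\mathbf{b}$. The rational Ehrhart counting function is $\operatorname{ehr}_{\mathbb{Q}}(P;\lambda)=|\lambda P\cap\mathbb{Z}^d|$ for rational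 $\lambda\ge0$. The series is a formal power series in $t^{1/(2r)}$. *)

theory Defs
  imports "HOL-Analysis.Analysis" "HOL-Computational_Algebra.Polynomial_FPS"
begin

definition lattice_point :: "real ^ 'd \<Rightarrow> bool" where
  "lattice_point x \<longleftrightarrow> (\<forall>i. x $ i \<in> \<int>)"

definition rational_point :: "real ^ 'd \<Rightarrow> bool" where
  "rational_point x \<longleftrightarrow> (\<forall>i. x $ i \<in> \<rat>)"

definition lattice_polytope :: "(real ^ 'd) set \<Rightarrow> bool" where
  "lattice_polytope P \<longleftrightarrow> (\<exists>V. finite V \<and> (\<forall>v\<in>V. lattice_point v) \<and> P = convex hull V)"

definition rational_polytope :: "(real ^ 'd) set \<Rightarrow> bool" where
  "rational_polytope P \<longleftrightarrow> (\<exists>V. finite V \<and> (\<forall>v\<in>V. rational_point v) \<and> P = convex hull V)"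

definition full_dimensional :: "(real ^ 'd) set \<Rightarrow> bool" where
  "full_dimensional P \<longleftrightarrow> aff_dim P = int CARD('d)"

text \<open>A system of inequalities \<open>A x \<le> b\<close> with integer data is given by the set of its rows
  \<open>(a, b)\<close>, each standing for \<open>a \<bullet> x \<le> b\<close>; an irredundant system has no repeated rows.\<close>

definition solution_set :: "((int ^ 'd) \<times> int) set \<Rightarrow> (real ^ 'd) set" where
  "solution_set H = {x. \<forall>(a, b)\<in>H. (\<Sum>i\<in>UNIV. of_int (a $ i) * x $ i) \<le> of_int b}"

definition irredundant_description :: "((int ^ 'd) \<times> int) set \<Rightarrow> (real ^ 'd) set \<Rightarrow> bool" where
  "irredundant_description H P \<longleftrightarrow>
     finite H \<and> P = solution_set H \<and>
     (\<forall>h\<in>H. solution_set (H - {h}) \<noteq> P) \<and>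
     (\<forall>(a, b)\<in>H. Gcd (insert b (range (\<lambda>i. a $ i))) = 1)"

text \<open>For a full-dimensional rational polytope exactly one \<open>H\<close> satisfies
  \<^const>\<open>irredundant_description\<close>, so the choice below is no choice. The set of nonzero
  right-hand sides is finite, hence its \<^const>\<open>Lcm\<close> is positive.\<close>

definition codenominator :: "(real ^ 'd) set \<Rightarrow> nat" where
  "codenominator P = nat (Lcm (snd ` (SOME H. irredundant_description H P) - {0}))"

definition ehr_rat :: "(real ^ 'd) set \<Rightarrow> rat \<Rightarrow> nat" where
  "ehr_rat P q = card {x \<in> (\<lambda>y. of_rat q *\<^sub>R y) ` P. lattice_point x}"

text \<open>The indeterminate \<^const>\<open>fps_X\<close> stands for \<open>t\<close> to the power \<open>1 / (2 r)\<close>, where \<open>r\<close> is the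
  codenominator of \<open>P\<close>. Coefficients are taken in the field of rationals so that quotients of
  power series are meaningful.\<close>

definition Ehr_ref :: "(real ^ 'd) set \<Rightarrow> rat fps" where
  "Ehr_ref P =
     1 + Abs_fps (\<lambda>n. if n > 0
                      then of_nat (ehr_rat P (of_nat n / of_nat (2 * codenominator P)))
                      else 0)"

end

theory Submission imports Defs begin

text \<open>Scale \<open>P\<close> by \<open>m / (2 r)\<close> to a lattice polytope \<open>Q\<close>. The coefficient of \<open>X ^ n\<close> counts the lattice points of
\<open>(n / m) Q\<close>, that is, the lattice points at height \<open>n\<close> in the cone \<open>K\<close> over \<open>Q\<close> placed at height
\<open>m\<close>. For \<open>m = 1\<close> the claim is Stanley's theorem on the numerator of an Ehrhart series, and its proof by
half-open decompositions needs only that the integral generators \<open>(v, m)\<close> of \<open>K\<close> share one positive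
height: cut \<open>K\<close> into disjoint half-open simplicial cones, each spanned by a basis \<open>B\<close> of the ambient
space that consists of generators. A lattice point of a half-open simplicial cone is, in a unique way, a lattice
point of its half-open parallelepiped plus a \<open>\<nat>\<close>-combination of \<open>B\<close>. So its series is (number of box points by height) over
\<open>(1 - X ^ m) ^ card B\<close>, where \<open>card B = d + 1\<close>, and the numerator of the sum counts box points.\<close>

text \<open>The decomposition comes from linear programming (\<open>half_open_decomposition\<close>). Give the generators generic
costs \<open>w\<close>, and keep those bases that satisfy the dual optimality conditions. A point in general position of
\<open>K\<close> lies in the open cone of exactly one of them: two optimal bases would each be at most as expensive as the
other (\<open>regular_bases_interior_unique\<close>), and a cheapest basis cone that contains the point is dual feasible, as
otherwise a simplex pivot lowers the cost (\<open>regular_bases_cover_generic\<close>). An arbitrary point \<open>y\<close> is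
assigned to the cone that contains \<open>y + e \<omega>\<close> for small \<open>e > 0\<close>, where \<open>\<omega>\<close> is a fixed generic
point of \<open>K\<close>. This decides which facets each cone keeps.\<close>

text \<open>All this presupposes \<open>r > 0\<close>. The codenominator is defined from an irredundant integral halfspace
description, so its positivity rests on the existence of such a description (\<open>codenominator_pos\<close>). That is
the Minkowski--Weyl theorem over the integers (\<open>integer_cone_halfspaces\<close>), proved by adding one generator at
a time and eliminating its coefficient from the inequalities.\<close>

section \<open>Weights in general position\<close>

text \<open>Along the moment curve \<open>v \<mapsto> s ^ i v\<close> each linear form becomes a nonzero polynomial in \<open>s\<close>. Finitely many
such polynomials have a common positive non-root.\<close>

lemma generic_positive_weights:
  fixes \<Phi> :: "('a \<Rightarrow> real) set"
  assumes "finite W" "finite \<Phi>" and nz: "\<And>\<phi>. \<phi> \<in> \<Phi> \<Longrightarrow> \<exists>v\<in>W. \<phi> v \<noteq> 0"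
  obtains w where "\<And>v. v \<in> W \<Longrightarrow> 0 < w v" "\<And>\<phi>. \<phi> \<in> \<Phi> \<Longrightarrow> (\<Sum>v\<in>W. \<phi> v * w v) \<noteq> (0::real)"
proof -
  obtain i :: "'a \<Rightarrow> nat" where i: "inj_on i W"
    using finite_imp_inj_to_nat_seg[OF \<open>finite W\<close>] by blast
  define p where "p \<phi> = (\<Sum>v\<in>W. monom (\<phi> v) (i v))" for \<phi> :: "'a \<Rightarrow> real"
  have "p \<phi> \<noteq> 0" if \<phi>: "\<phi> \<in> \<Phi>" for \<phi>
  proof -
    obtain v where v: "v \<in> W" "\<phi> v \<noteq> 0" using nz[OF \<phi>] by blast
    have "coeff (p \<phi>) (i v) = (\<Sum>u\<in>W. if i u = i v then \<phi> u else 0)"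
      by (simp add: p_def coeff_sum)
    also have "\<dots> = (\<Sum>u\<in>W. if u = v then \<phi> u else 0)"
      using i v by (intro sum.cong) (auto simp: inj_on_def)
    also have "\<dots> = \<phi> v" using v \<open>finite W\<close> by simp
    finally show ?thesis using v by auto
  qed
  let ?R = "\<Union>\<phi>\<in>\<Phi>. {s. poly (p \<phi>) s = 0}"
  have "finite ?R"
    using \<open>finite \<Phi>\<close> poly_roots_finite \<open>\<And>\<phi>. \<phi> \<in> \<Phi> \<Longrightarrow> p \<phi> \<noteq> 0\<close> by blast
  then have "infinite ({0<..} - ?R)" using infinite_Ioi by (rule Diff_infinite_finite)
  then have "{0<..} - ?R \<noteq> {}" by (rule infinite_imp_nonempty)
  then obtain s where s: "0 < s" "s \<notin> ?R" by blast
  show thesis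
  proof (rule that[of "\<lambda>v. s ^ i v"])
    show "(\<Sum>v\<in>W. \<phi> v * s ^ i v) \<noteq> 0" if "\<phi> \<in> \<Phi>" for \<phi>
      using s(2) that by (auto simp: p_def poly_sum poly_monom)
  qed (use s in auto)
qed

section \<open>Conic combinations and coordinates in bases of generators\<close>

lemma convex_cone_hull_finite:
  assumes "finite W"
  shows "convex_cone hull W = {\<Sum>v\<in>W. c v *\<^sub>R v |c. \<forall>v\<in>W. 0 \<le> c v}" (is "?l = ?r")
proof
  have "convex_cone ?r"
    unfolding convex_cone_iff
  proof (intro conjI ballI allI impI)
    show "0 \<in> ?r" by (intro CollectI exI[of _ "\<lambda>_. 0"]) auto
  next
    fix x y assume "x \<in> ?r" "y \<in> ?r"
    then obtain c d where "x = (\<Sum>v\<in>W. c v *\<^sub>R v)" "\<forall>v\<in>W. 0 \<le> c v"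
      "y = (\<Sum>v\<in>W. d v *\<^sub>R v)" "\<forall>v\<in>W. 0 \<le> d v" by blast
    then show "x + y \<in> ?r"
      by (intro CollectI exI[of _ "\<lambda>v. c v + d v"]) (simp add: scaleR_add_left sum.distrib)
  next
    fix x and k :: real assume "x \<in> ?r" "0 \<le> k"
    then obtain c where "x = (\<Sum>v\<in>W. c v *\<^sub>R v)" "\<forall>v\<in>W. 0 \<le> c v" by blast
    then show "k *\<^sub>R x \<in> ?r" using \<open>0 \<le> k\<close>
      by (intro CollectI exI[of _ "\<lambda>v. k * c v"]) (simp add: scaleR_sum_right)
  qed
  moreover have "W \<subseteq> ?r"
  proof
    fix x assume "x \<in> W"
    have "(\<Sum>v\<in>W. (if v = x then 1 else 0) *\<^sub>R v) = (\<Sum>v\<in>W. if v = x then v else 0)"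
      by (intro sum.cong) auto
    also have "\<dots> = x" using \<open>x \<in> W\<close> assms by simp
    finally show "x \<in> ?r"
      by (intro CollectI exI[of _ "\<lambda>v. if v = x then 1 else 0"]) auto
  qed
  ultimately show "?l \<subseteq> ?r" by (rule hull_minimal[rotated])
  show "?r \<subseteq> ?l"
  proof clarify
    fix c :: "'a \<Rightarrow> real" assume c: "\<forall>v\<in>W. 0 \<le> c v"
    have "(\<Sum>v\<in>U. c v *\<^sub>R v) \<in> convex_cone hull W" if "U \<subseteq> W" for U
      using finite_subset[OF that assms] that
      by (induction U rule: finite_induct)
        (auto simp: convex_cone_hull_contains_0 c intro!: convex_cone_hull_add convex_cone_hull_mul intro: hull_inc)
    then show "(\<Sum>v\<in>W. c v *\<^sub>R v) \<in> convex_cone hull W" by blast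
  qed
qed

definition bases_in :: "'a::euclidean_space set \<Rightarrow> 'a set set" where
  "bases_in W = {B. B \<subseteq> W \<and> independent B \<and> span B = UNIV}"

lemma
  fixes B W :: "'a::euclidean_space set"
  assumes "B \<in> bases_in W"
  shows bases_in_subset: "B \<subseteq> W" and bases_in_independent: "independent B"
    and bases_in_finite: "finite B"
    and bases_in_card: "card B = DIM('a)"
proof -
  show "B \<subseteq> W" "independent B" "finite B"
    using assms independent_imp_finite by (auto simp: bases_in_def)
  moreover have "span B = UNIV" using assms by (simp add: bases_in_def)
  ultimately show "card B = DIM('a)" by (metis dim_UNIV dim_span_eq_card_independent)
qed

lemma finite_bases_in: "finite W \<Longrightarrow> finite (bases_in W)"
  by (rule finite_subset[of _ "Pow W"]) (auto simp: bases_in_def)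

lemma sum_representation_basis:
  fixes B :: "'a::euclidean_space set"
  assumes "B \<in> bases_in W"
  shows "(\<Sum>b\<in>B. representation B z b *\<^sub>R b) = z"
  using assms by (intro sum_representation_eq) (auto simp: bases_in_def independent_imp_finite)

lemma representation_basis_add:
  fixes B :: "'a::euclidean_space set"
  assumes "B \<in> bases_in W"
  shows "representation B (x + y) b = representation B x b + representation B y b"
  using assms by (simp add: representation_add bases_in_def)

lemma representation_basis_scale:
  fixes B :: "'a::euclidean_space set"
  assumes "B \<in> bases_in W"
  shows "representation B (k *\<^sub>R x) b = k * representation B x b"
  using assms by (simp add: representation_scale bases_in_def)

lemma representation_basis_diff:
  fixes B :: "'a::euclidean_space set"
  assumes "B \<in> bases_in W"
  shows "representation B (x - y) b = representation B x b - representation B y b"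
  using assms by (simp add: representation_diff bases_in_def)

lemma representation_basis_sum:
  fixes B :: "'a::euclidean_space set"
  assumes "B \<in> bases_in W"
  shows "representation B (\<Sum>x\<in>X. f x *\<^sub>R x) b = (\<Sum>x\<in>X. f x * representation B x b)"
  using assms by (simp add: representation_sum representation_scale bases_in_def)

lemma representation_basis_member:
  fixes B :: "'a::euclidean_space set"
  assumes "B \<in> bases_in W" "v \<in> B"
  shows "representation B v b = (if b = v then 1 else 0)"
  using assms by (simp add: representation_basis bases_in_def)

lemma representation_basis_unique:
  fixes B :: "'a::euclidean_space set"
  assumes B: "B \<in> bases_in W" and "b \<in> B"
  shows "representation B (\<Sum>x\<in>B. f x *\<^sub>R x) b = f b"
proof -
  have "representation B (\<Sum>x\<in>B. f x *\<^sub>R x) b = (\<Sum>x\<in>B. f x * (if b = x then 1 else 0))"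
    by (simp add: representation_basis_sum[OF B] representation_basis_member[OF B])
  also have "\<dots> = f b" using bases_in_finite[OF B] \<open>b \<in> B\<close> by (simp add: if_distrib cong: if_cong)
  finally show ?thesis .
qed

lemma basis_exchange:
  fixes B :: "'a::euclidean_space set"
  assumes B: "B \<in> bases_in W" and v: "v \<in> W" "v \<notin> B" and b: "b \<in> B" "representation B v b \<noteq> 0"
  shows "insert v (B - {b}) \<in> bases_in W"
proof -
  note fin = bases_in_finite[OF B]
  have "v \<notin> span (B - {b})"
  proof
    assume "v \<in> span (B - {b})"
    then obtain f where f: "v = (\<Sum>x\<in>B - {b}. f x *\<^sub>R x)"
      using fin by (auto simp: span_finite)
    have "representation B v b = (\<Sum>x\<in>B - {b}. f x * representation B x b)"
      by (subst f) (simp add: representation_basis_sum[OF B])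
    also have "\<dots> = 0"
      by (intro sum.neutral) (auto simp: representation_basis_member[OF B])
    finally show False using b by simp
  qed
  then have ind: "independent (insert v (B - {b}))"
    using independent_mono[OF bases_in_independent[OF B], of "B - {b}"] by (simp add: independent_insertI)
  have "card (insert v (B - {b})) = DIM('a)"
    using fin v b bases_in_card[OF B] by (simp add: card_Suc_Diff1)
  then have "UNIV \<subseteq> span (insert v (B - {b}))"
    using card_eq_dim[of "insert v (B - {b})" UNIV] ind fin by simp
  then show ?thesis using ind v bases_in_subset[OF B] by (auto simp: bases_in_def)
qed

section \<open>Linear programming over a finitely generated cone\<close>

text \<open>Starting from \<open>c\<close> and moving in direction \<open>- u\<close>, the largest feasible step \<open>t\<close> makes some coordinate
\<open>x\<close> vanish. This serves both the reduction of a conic combination and the simplex pivot.\<close>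

lemma ratio_test:
  fixes c u :: "'a \<Rightarrow> real"
  assumes "finite S" and c: "\<And>x. x \<in> S \<Longrightarrow> 0 \<le> c x" and "\<exists>x\<in>S. 0 < u x"
  obtains t x where "x \<in> S" "0 < u x" "t = c x / u x" "0 \<le> t" "\<And>y. y \<in> S \<Longrightarrow> 0 \<le> c y - t * u y"
proof -
  let ?U = "{x \<in> S. 0 < u x}"
  have U: "finite ?U" "?U \<noteq> {}" using assms by auto
  define x where "x = arg_min_on (\<lambda>x. c x / u x) ?U"
  have x: "x \<in> S" "0 < u x" using arg_min_if_finite(1)[OF U] by (auto simp: x_def)
  have min: "c x / u x \<le> c y / u y" if "y \<in> ?U" for y
    using arg_min_least[OF U that, of "\<lambda>x. c x / u x"] by (simp add: x_def)
  show thesis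
  proof (rule that[OF x refl])
    show t0: "0 \<le> c x / u x" using c x by simp
    show "0 \<le> c y - c x / u x * u y" if "y \<in> S" for y
    proof (cases "0 < u y")
      case True
      then have "c x / u x \<le> c y / u y" using min[of y] that by simp
      then show ?thesis using True by (simp add: pos_le_divide_eq)
    next
      case False
      then have "c x / u x * u y \<le> 0" by (intro mult_nonneg_nonpos t0) auto
      then show ?thesis using c[OF that] by linarith
    qed
  qed
qed

text \<open>A conic combination of minimal support uses independent vectors: subtracting a suitable multiple of a linear
relation would remove one of them.\<close>

lemma conic_caratheodory:
  fixes W :: "'a::euclidean_space set"
  assumes "finite W" "z \<in> convex_cone hull W"
  obtains S c where "S \<subseteq> W" "independent S" "\<And>v. v \<in> S \<Longrightarrow> 0 \<le> c v" "z = (\<Sum>v\<in>S. c v *\<^sub>R v)"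
proof -
  define ok where "ok S \<longleftrightarrow> S \<subseteq> W \<and> (\<exists>c. (\<forall>v\<in>S. 0 \<le> c v) \<and> z = (\<Sum>v\<in>S. c v *\<^sub>R v))" for S
  have "ok W" using assms by (auto simp: ok_def convex_cone_hull_finite)
  then obtain S where S: "ok S" and min: "\<And>S'. ok S' \<Longrightarrow> card S \<le> card S'"
    using exists_least_iff[of "\<lambda>n. \<exists>S. ok S \<and> card S = n"] by (metis linorder_not_less)
  from S obtain c where c: "S \<subseteq> W" "\<And>v. v \<in> S \<Longrightarrow> 0 \<le> c v" "z = (\<Sum>v\<in>S. c v *\<^sub>R v)"
    by (auto simp: ok_def)
  have fin: "finite S" using c(1) assms(1) finite_subset by blast
  have "independent S"
  proof
    assume "dependent S"
    then obtain u where u: "\<exists>v\<in>S. u v \<noteq> 0" "(\<Sum>v\<in>S. u v *\<^sub>R v) = 0"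
      using dependent_finite[OF fin] by auto
    \<comment> \<open>The ratio test needs a positive coefficient, so the relation may have to change sign.\<close>
    obtain u' where u': "\<exists>v\<in>S. 0 < u' v" "(\<Sum>v\<in>S. u' v *\<^sub>R v) = 0"
    proof (cases "\<exists>v\<in>S. 0 < u v")
      case False
      then show ?thesis using u
        by (intro that[of "\<lambda>v. - u v"]) (auto simp: sum_negf, meson linorder_neqE)
    qed (use u in \<open>blast intro: that\<close>)
    obtain t x where tx: "x \<in> S" "0 < u' x" "t = c x / u' x" "\<And>y. y \<in> S \<Longrightarrow> 0 \<le> c y - t * u' y"
      using ratio_test[of S c u'] fin c(2) u'(1) by metis
    have "(\<Sum>v\<in>S - {x}. (c v - t * u' v) *\<^sub>R v) = (\<Sum>v\<in>S. (c v - t * u' v) *\<^sub>R v)"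
      using fin tx by (intro sum.mono_neutral_left) auto
    also have "\<dots> = z - t *\<^sub>R (\<Sum>v\<in>S. u' v *\<^sub>R v)"
      by (simp add: c(3) scaleR_diff_left sum_subtractf scaleR_sum_right)
    finally have "ok (S - {x})" using u'(2) tx c(1) by (auto simp: ok_def intro!: exI[of _ "\<lambda>v. c v - t * u' v"])
    then show False using min[of "S - {x}"] card_Diff1_less[OF fin tx(1)] by linarith
  qed
  then show thesis using that c by blast
qed

text \<open>The linear functional that agrees with \<open>w\<close> on the basis \<open>B\<close>. In terms of linear programming, it is the dual
solution of \<open>B\<close>; at a point of the cone of \<open>B\<close> it is the cost of its representation by \<open>B\<close>.\<close>

definition price :: "('a::euclidean_space \<Rightarrow> real) \<Rightarrow> 'a set \<Rightarrow> 'a \<Rightarrow> real" where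
  "price w B z = (\<Sum>b\<in>B. representation B z b * w b)"

text \<open>The bases with strictly positive reduced costs. For generic heights \<open>w\<close> their cones are the maximal cones of
the regular triangulation that \<open>w\<close> induces.\<close>

definition regular_bases :: "('a::euclidean_space \<Rightarrow> real) \<Rightarrow> 'a set \<Rightarrow> 'a set set" where
  "regular_bases w W = {B \<in> bases_in W. \<forall>v\<in>W - B. price w B v < w v}"

lemma price_member:
  assumes B: "B \<in> bases_in W" "v \<in> B"
  shows "price w B v = w v"
proof -
  have "price w B v = (\<Sum>b\<in>B. if b = v then w b else 0)"
    by (auto simp: price_def representation_basis_member[OF B] intro!: sum.cong)
  then show ?thesis using bases_in_finite[OF B(1)] B(2) by simp
qed

lemma price_sum:
  assumes B: "B \<in> bases_in W"
  shows "price w B (\<Sum>x\<in>X. f x *\<^sub>R x) = (\<Sum>x\<in>X. f x * price w B x)"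
  unfolding price_def representation_basis_sum[OF B] sum_distrib_right sum_distrib_left
  by (subst sum.swap) (simp add: mult.assoc)

text \<open>Weak duality: the functional of a dual feasible basis \<open>B\<close> is at most \<open>w\<close> on all generators, so \<open>B\<close>
represents \<open>z\<close> at most as expensively as \<open>C\<close>, and strictly more cheaply if \<open>C\<close> uses a generator outside
\<open>B\<close> with a positive coefficient. Exchanging the roles of \<open>B\<close> and \<open>C\<close> forces equality.\<close>

lemma regular_bases_interior_unique:
  assumes "B \<in> regular_bases w W" "C \<in> regular_bases w W"
    and "\<And>b. b \<in> B \<Longrightarrow> 0 < representation B z b" "\<And>b. b \<in> C \<Longrightarrow> 0 < representation C z b"
  shows "B = C"
proof -
  have half: "price w B z \<le> price w C z \<and> (price w B z = price w C z \<longrightarrow> C \<subseteq> B)"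
    if BC: "B \<in> regular_bases w W" "C \<in> regular_bases w W"
      and pos: "\<And>b. b \<in> C \<Longrightarrow> 0 < representation C z b" for B C
  proof -
    have B: "B \<in> bases_in W" and C: "C \<in> bases_in W" using BC by (auto simp: regular_bases_def)
    have eq: "price w B z = (\<Sum>c\<in>C. representation C z c * price w B c)"
      using price_sum[OF B, of w "\<lambda>c. representation C z c" C] by (simp add: sum_representation_basis[OF C])
    have le: "representation C z c * price w B c \<le> representation C z c * w c" if "c \<in> C" for c
    proof (rule mult_left_mono)
      show "price w B c \<le> w c"
        using BC(1) bases_in_subset[OF C] that price_member[OF B, of c w]
        by (cases "c \<in> B") (auto simp: regular_bases_def less_imp_le)
    qed (use pos[OF that] in simp)
    have "price w B z < price w C z" if "c \<in> C" "c \<notin> B" for c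
      unfolding eq price_def[of w C]
    proof (rule sum_strict_mono_ex1)
      show "\<exists>c\<in>C. representation C z c * price w B c < representation C z c * w c"
        using that BC(1) bases_in_subset[OF C] pos[OF that(1)]
        by (intro bexI[OF _ that(1)]) (auto simp: regular_bases_def)
    qed (use le bases_in_finite[OF C] in auto)
    moreover have "price w B z \<le> price w C z"
      unfolding eq price_def[of w C] by (intro sum_mono le)
    ultimately show ?thesis by fastforce
  qed
  from half[OF assms(1,2,4)] half[OF assms(2,1,3)] show ?thesis by force
qed

text \<open>Among the finitely many basis cones that contain \<open>z\<close>, take one of minimal cost. If some generator \<open>v\<close> were
underpriced, a pivot would bring \<open>v\<close> into the basis at a step \<open>t > 0\<close>, since \<open>z\<close> has no zero coordinate,
and the cost would drop. The positive functional \<open>ht\<close> excludes an unbounded pivot.\<close>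

lemma regular_bases_cover_generic:
  fixes W :: "'a::euclidean_space set"
  assumes fin: "finite W" and span: "span W = UNIV"
    and ht: "linear ht" "\<And>v. v \<in> W \<Longrightarrow> 0 < (ht v :: real)"
    and w: "\<And>B v. B \<in> bases_in W \<Longrightarrow> v \<in> W - B \<Longrightarrow> price w B v \<noteq> w v"
    and z: "z \<in> convex_cone hull W"
    and gen: "\<And>B b. B \<in> bases_in W \<Longrightarrow> b \<in> B \<Longrightarrow> representation B z b \<noteq> 0"
  obtains B where "B \<in> regular_bases w W" "\<And>b. b \<in> B \<Longrightarrow> 0 < representation B z b"
proof -
  define F where "F = {B \<in> bases_in W. \<forall>b\<in>B. 0 < representation B z b}"
  have finF: "finite F" using finite_bases_in[OF fin] by (auto simp: F_def)
  \<comment> \<open>Genericity of \<open>z\<close> turns membership in a closed basis cone into membership in its interior.\<close>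
  have F_I: "B \<in> F" if B: "B \<in> bases_in W" and "z = (\<Sum>b\<in>B. c b *\<^sub>R b)" "\<And>b. b \<in> B \<Longrightarrow> 0 \<le> c b" for B c
    using that gen[OF B] representation_basis_unique[OF B, of _ c] by (auto simp: F_def less_le)
  have "F \<noteq> {}"
  proof -
    obtain S c where S: "S \<subseteq> W" "independent S" "\<And>v. v \<in> S \<Longrightarrow> 0 \<le> c v" "z = (\<Sum>v\<in>S. c v *\<^sub>R v)"
      using conic_caratheodory[OF fin z] by metis
    obtain B where SB: "S \<subseteq> B" "B \<subseteq> W" "independent B" "W \<subseteq> span B"
      using maximal_independent_subset_extend[OF S(1,2)] .
    have "span B = UNIV" using SB(4) span by (metis span_mono span_span top.extremum_uniqueI)
    then have B: "B \<in> bases_in W" using SB by (auto simp: bases_in_def)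
    have "z = (\<Sum>v\<in>B. (if v \<in> S then c v else 0) *\<^sub>R v)"
      unfolding S(4) using SB(1) bases_in_finite[OF B] by (intro sum.mono_neutral_cong_left) auto
    then have "B \<in> F" by (rule F_I[OF B]) (use S(3) in auto)
    then show ?thesis by blast
  qed
  then obtain B where BF: "B \<in> F" and min: "\<And>C. C \<in> F \<Longrightarrow> price w B z \<le> price w C z"
    using arg_min_if_finite(1)[OF finF, of "\<lambda>B. price w B z"] arg_min_least[OF finF, of _ "\<lambda>B. price w B z"]
    by blast
  then have B: "B \<in> bases_in W" and pos: "\<And>b. b \<in> B \<Longrightarrow> 0 < representation B z b" by (auto simp: F_def)
  note finB = bases_in_finite[OF B]
  have "price w B v < w v" if v: "v \<in> W - B" for v
  proof (rule ccontr)
    assume "\<not> price w B v < w v"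
    then have less: "w v < price w B v" using w[OF B v] by linarith
    let ?u = "representation B v" and ?c = "representation B z"
    \<comment> \<open>Otherwise the height of \<open>v\<close> would not be positive.\<close>
    have "\<exists>b\<in>B. 0 < ?u b"
    proof (rule ccontr)
      assume "\<not> (\<exists>b\<in>B. 0 < ?u b)"
      then have "(\<Sum>b\<in>B. ?u b * ht b) \<le> 0"
        using ht(2) bases_in_subset[OF B] by (intro sum_nonpos mult_nonpos_nonneg) (auto simp: less_imp_le not_less)
      moreover have "(\<Sum>b\<in>B. ?u b * ht b) = ht v"
        using arg_cong[OF sum_representation_basis[OF B, of v], of ht] ht(1)
        by (simp add: linear_sum linear_scale)
      ultimately show False using ht(2)[of v] v by auto
    qed
    then obtain t x where tx: "x \<in> B" "0 < ?u x" "t = ?c x / ?u x" "\<And>y. y \<in> B \<Longrightarrow> 0 \<le> ?c y - t * ?u y"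
      using ratio_test[of B ?c ?u] finB pos by (metis less_imp_le)
    have t: "0 < t" using tx pos by simp
    \<comment> \<open>The new basis and the coordinates of \<open>z\<close> in it; the coordinate of \<open>x\<close> has become zero.\<close>
    let ?C = "insert v (B - {x})"
    let ?f = "\<lambda>y. if y = v then t else ?c y - t * ?u y"
    have C: "?C \<in> bases_in W" using basis_exchange[OF B, of v x] v tx by auto
    \<comment> \<open>The vectors and their costs are summed in the same way, so one identity serves \<open>z\<close> and its price.\<close>
    have key: "(\<Sum>y\<in>?C. g (?f y) y) = g t v + (\<Sum>y\<in>B. g (?c y - t * ?u y) y)"
      if "\<And>y. g 0 y = 0" for g :: "real \<Rightarrow> 'a \<Rightarrow> 'b::ab_group_add"
    proof -
      have "(\<Sum>y\<in>B - {x}. g (?f y) y) = (\<Sum>y\<in>B - {x}. g (?c y - t * ?u y) y)"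
        by (rule sum.cong[OF refl]) (use v in auto)
      then have "(\<Sum>y\<in>?C. g (?f y) y) = g t v + (\<Sum>y\<in>B - {x}. g (?c y - t * ?u y) y)"
        using finB v by (subst sum.insert) auto
      also have "(\<Sum>y\<in>B - {x}. g (?c y - t * ?u y) y) = (\<Sum>y\<in>B. g (?c y - t * ?u y) y)"
        using finB tx that by (intro sum.mono_neutral_left) auto
      finally show ?thesis .
    qed
    have zC: "z = (\<Sum>y\<in>?C. ?f y *\<^sub>R y)"
    proof -
      have "(\<Sum>y\<in>?C. ?f y *\<^sub>R y) = t *\<^sub>R v + (\<Sum>y\<in>B. (?c y - t * ?u y) *\<^sub>R y)"
        by (rule key) simp
      also have "(\<Sum>y\<in>B. (?c y - t * ?u y) *\<^sub>R y) = z - t *\<^sub>R v"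
        using sum_representation_basis[OF B]
        by (simp add: scaleR_diff_left sum_subtractf flip: scaleR_scaleR scaleR_sum_right)
      finally show ?thesis by simp
    qed
    have "?C \<in> F" by (rule F_I[OF C zC]) (use tx t in auto)
    have "price w ?C z = (\<Sum>y\<in>?C. ?f y * w y)"
      unfolding price_def using zC representation_basis_unique[OF C, of _ ?f]
      by (intro sum.cong) auto
    also have "\<dots> = t * w v + (\<Sum>y\<in>B. (?c y - t * ?u y) * w y)"
      by (rule key) simp
    also have "\<dots> = price w B z + t * (w v - price w B v)"
      by (simp add: price_def algebra_simps sum_subtractf sum_distrib_left)
    also have "\<dots> < price w B z" using t less by (simp add: mult_pos_neg)
    finally show False using min[OF \<open>?C \<in> F\<close>] by linarith
  qed
  then show thesis using that[of B] B pos by (auto simp: regular_bases_def)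
qed

section \<open>Decomposition into half-open simplicial cones\<close>

text \<open>The facet opposite to \<open>b\<close> is removed exactly for \<open>b \<in> N\<close>.\<close>

definition half_open_cone :: "'a::euclidean_space set \<Rightarrow> 'a set \<Rightarrow> 'a set" where
  "half_open_cone B N = {z. \<forall>b\<in>B. 0 \<le> representation B z b \<and> (b \<in> N \<longrightarrow> 0 < representation B z b)}"

text \<open>Push a point \<open>y\<close> slightly towards a generic point \<open>\<omega>\<close> of the cone. For small \<open>e > 0\<close> the point
\<open>y + e \<omega>\<close> is generic, so it lies in the interior of exactly one regular basis cone, and it lies in the
interior of the cone of \<open>B\<close> iff every coordinate of \<open>y\<close> is positive, or is zero with the coordinate of
\<open>\<omega>\<close> positive. This is the condition of a half-open cone.\<close>

theorem half_open_decomposition: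
  fixes W :: "'a::euclidean_space set"
  assumes fin: "finite W" and span: "span W = UNIV"
    and ht: "linear ht" "\<And>v. v \<in> W \<Longrightarrow> 0 < (ht v :: real)"
  obtains T N where "T \<subseteq> bases_in W"
    "convex_cone hull W = (\<Union>B\<in>T. half_open_cone B (N B))"
    "disjoint_family_on (\<lambda>B. half_open_cone B (N B)) T"
proof -
  let ?I = "Sigma (bases_in W) (\<lambda>B. B)"
  have finI: "finite ?I"
    using finite_bases_in[OF fin] bases_in_finite by blast
  obtain \<alpha> where \<alpha>: "\<And>v. v \<in> W \<Longrightarrow> 0 < \<alpha> v"
    "\<And>B b. B \<in> bases_in W \<Longrightarrow> b \<in> B \<Longrightarrow> (\<Sum>v\<in>W. representation B v b * \<alpha> v) \<noteq> 0"
  proof -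
    obtain \<alpha> where "\<And>v. v \<in> W \<Longrightarrow> 0 < \<alpha> v"
      "\<And>\<phi>. \<phi> \<in> (\<lambda>(B, b) v. representation B v b) ` ?I \<Longrightarrow> (\<Sum>v\<in>W. \<phi> v * \<alpha> v) \<noteq> (0::real)"
    proof (rule generic_positive_weights[OF fin, of "(\<lambda>(B, b) v. representation B v b) ` ?I"])
      fix \<phi> assume "\<phi> \<in> (\<lambda>(B, b) v. representation B v b) ` ?I"
      then obtain B b where B: "B \<in> bases_in W" "b \<in> B" "\<phi> = (\<lambda>v. representation B v b)" by auto
      then show "\<exists>v\<in>W. \<phi> v \<noteq> 0"
        using bases_in_subset[OF B(1)] by (intro bexI[of _ b]) (auto simp: representation_basis_member[OF B(1,2)])
    qed (use finI in auto)
    then show ?thesis by (intro that[of \<alpha>]) fastforce+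
  qed
  define \<omega> where "\<omega> = (\<Sum>v\<in>W. \<alpha> v *\<^sub>R v)"
  have \<omega>0: "representation B \<omega> b \<noteq> 0" if "B \<in> bases_in W" "b \<in> B" for B b
    using \<alpha>(2)[OF that] by (simp add: \<omega>_def representation_basis_sum[OF that(1)] mult.commute)
  have \<omega>K: "\<omega> \<in> convex_cone hull W"
    using \<alpha>(1) unfolding \<omega>_def convex_cone_hull_finite[OF fin] by (blast intro: less_imp_le)
  \<comment> \<open>Costs without ties: each \<open>\<phi> (B, v)\<close> is the linear form in the costs whose value is the reduced cost of \<open>v\<close>.\<close>
  obtain w :: "'a \<Rightarrow> real" where w: "\<And>B v. B \<in> bases_in W \<Longrightarrow> v \<in> W - B \<Longrightarrow> price w B v \<noteq> w v"
  proof -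
    define \<phi> :: "'a set \<times> 'a \<Rightarrow> 'a \<Rightarrow> real" where "\<phi> = (\<lambda>(B, v) u. if u = v then 1 else if u \<in> B then - representation B v u else 0)"
    let ?J = "Sigma (bases_in W) (\<lambda>B. W - B)"
    obtain w where w: "\<And>v. v \<in> W \<Longrightarrow> 0 < w v" "\<And>f. f \<in> \<phi> ` ?J \<Longrightarrow> (\<Sum>u\<in>W. f u * w u) \<noteq> (0::real)"
    proof (rule generic_positive_weights[OF fin, of "\<phi> ` ?J"])
      show "finite (\<phi> ` ?J)" using finite_bases_in[OF fin] fin by blast
      show "\<exists>u\<in>W. f u \<noteq> 0" if "f \<in> \<phi> ` ?J" for f
        using that by (auto simp: \<phi>_def)
    qed blast
    show ?thesis
    proof (rule that[of w])
      fix B v assume B: "B \<in> bases_in W" and v: "v \<in> W - B"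
      have "(\<Sum>u\<in>W. \<phi> (B, v) u * w u) = (\<Sum>u\<in>insert v B. \<phi> (B, v) u * w u)"
        using fin v bases_in_subset[OF B] by (intro sum.mono_neutral_right) (auto simp: \<phi>_def)
      also have "\<dots> = w v + (\<Sum>u\<in>B. \<phi> (B, v) u * w u)"
        using v bases_in_finite[OF B] by (simp add: \<phi>_def)
      also have "(\<Sum>u\<in>B. \<phi> (B, v) u * w u) = - price w B v"
        unfolding price_def sum_negf[symmetric] using v by (intro sum.cong) (auto simp: \<phi>_def)
      finally show "price w B v \<noteq> w v" using w(2)[of "\<phi> (B, v)"] B v by auto
    qed
  qed
  define N where "N B = {b. representation B \<omega> b < 0}" for B
  \<comment> \<open>As \<open>e\<close> tends to zero, each of the finitely many coordinates of \<open>y + e \<omega>\<close> has a constant nonzero sign.\<close>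
  have push: "\<exists>e>0. \<forall>(B, b)\<in>?I. representation B (y + e *\<^sub>R \<omega>) b \<noteq> 0 \<and>
      (0 < representation B (y + e *\<^sub>R \<omega>) b \<longleftrightarrow> 0 \<le> representation B y b \<and> (b \<in> N B \<longrightarrow> 0 < representation B y b))" for y
  proof -
    have "\<forall>\<^sub>F e in at_right 0. representation B (y + e *\<^sub>R \<omega>) b \<noteq> 0 \<and>
      (0 < representation B (y + e *\<^sub>R \<omega>) b \<longleftrightarrow> 0 \<le> representation B y b \<and> (b \<in> N B \<longrightarrow> 0 < representation B y b))"
      if "(B, b) \<in> ?I" for B b
    proof -
      have B: "B \<in> bases_in W" "b \<in> B" using that by auto
      let ?a = "representation B y b" and ?d = "representation B \<omega> b"
      have eq: "representation B (y + e *\<^sub>R \<omega>) b = ?a + e * ?d" for e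
        by (simp add: representation_basis_add[OF B(1)] representation_basis_scale[OF B(1)])
      have lim: "((\<lambda>e. ?a + e * ?d) \<longlongrightarrow> ?a) (at_right 0)"
        by (auto intro!: tendsto_eq_intros)
      consider "?a > 0" | "?a < 0" | "?a = 0" by linarith
      then show ?thesis
      proof cases
        case 1
        show ?thesis using order_tendstoD(1)[OF lim 1] unfolding eq by eventually_elim (use 1 in auto)
      next
        case 2
        show ?thesis using order_tendstoD(2)[OF lim 2] unfolding eq by eventually_elim (use 2 in auto)
      next
        case 3
        have "\<forall>\<^sub>F e in at_right (0::real). 0 < e" by (simp add: eventually_at_right_less)
        then show ?thesis unfolding eq
          by eventually_elim (use 3 \<omega>0[OF B] in \<open>auto simp: N_def zero_less_mult_iff\<close>)
      qed
    qed
    then have "\<forall>\<^sub>F e in at_right 0. \<forall>(B, b)\<in>?I. representation B (y + e *\<^sub>R \<omega>) b \<noteq> 0 \<and>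
      (0 < representation B (y + e *\<^sub>R \<omega>) b \<longleftrightarrow> 0 \<le> representation B y b \<and> (b \<in> N B \<longrightarrow> 0 < representation B y b))"
      by (intro eventually_ball_finite finI) auto
    moreover have "\<forall>\<^sub>F e in at_right (0::real). 0 < e" by (simp add: eventually_at_right_less)
    ultimately have "\<forall>\<^sub>F e in at_right 0. 0 < e \<and> (\<forall>(B, b)\<in>?I. representation B (y + e *\<^sub>R \<omega>) b \<noteq> 0 \<and>
      (0 < representation B (y + e *\<^sub>R \<omega>) b \<longleftrightarrow> 0 \<le> representation B y b \<and> (b \<in> N B \<longrightarrow> 0 < representation B y b)))"
      by eventually_elim blast
    then show ?thesis by (metis (no_types, lifting) eventually_happens trivial_limit_at_right_real)
  qed
  show thesis
  proof (rule that[of "regular_bases w W" N])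
    show "regular_bases w W \<subseteq> bases_in W" by (auto simp: regular_bases_def)
    show "disjoint_family_on (\<lambda>B. half_open_cone B (N B)) (regular_bases w W)"
      unfolding disjoint_family_on_def
    proof (intro ballI impI)
      fix B C assume BC: "B \<in> regular_bases w W" "C \<in> regular_bases w W" "B \<noteq> C"
      have "\<not> (y \<in> half_open_cone B (N B) \<and> y \<in> half_open_cone C (N C))" for y
      proof
        assume y: "y \<in> half_open_cone B (N B) \<and> y \<in> half_open_cone C (N C)"
        obtain e where "\<forall>(B, b)\<in>?I. 0 < representation B (y + e *\<^sub>R \<omega>) b \<longleftrightarrow>
            0 \<le> representation B y b \<and> (b \<in> N B \<longrightarrow> 0 < representation B y b)"
          using push[of y] by fast
        then have "B = C"
          using y BC(1,2)
          by (intro regular_bases_interior_unique[OF BC(1,2), of "y + e *\<^sub>R \<omega>"])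
            (auto simp: half_open_cone_def regular_bases_def)
        then show False using BC(3) by simp
      qed
      then show "half_open_cone B (N B) \<inter> half_open_cone C (N C) = {}" by blast
    qed
    show "convex_cone hull W = (\<Union>B\<in>regular_bases w W. half_open_cone B (N B))"
    proof (intro equalityI subsetI)
      fix y assume y: "y \<in> convex_cone hull W"
      obtain e where e: "0 < e" "\<forall>(B, b)\<in>?I. representation B (y + e *\<^sub>R \<omega>) b \<noteq> 0 \<and>
         (0 < representation B (y + e *\<^sub>R \<omega>) b \<longleftrightarrow> 0 \<le> representation B y b \<and> (b \<in> N B \<longrightarrow> 0 < representation B y b))"
        using push[of y] by fast
      have zK: "y + e *\<^sub>R \<omega> \<in> convex_cone hull W"
        using y \<omega>K e(1) by (intro convex_cone_hull_add convex_cone_hull_mul) auto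
      obtain B where B: "B \<in> regular_bases w W" "\<And>b. b \<in> B \<Longrightarrow> 0 < representation B (y + e *\<^sub>R \<omega>) b"
        by (rule regular_bases_cover_generic[OF fin span ht w zK]) (use e in auto)
      then have "y \<in> half_open_cone B (N B)"
        using e(2) by (auto simp: half_open_cone_def regular_bases_def)
      then show "y \<in> (\<Union>B\<in>regular_bases w W. half_open_cone B (N B))" using B by blast
    next
      fix y assume "y \<in> (\<Union>B\<in>regular_bases w W. half_open_cone B (N B))"
      then obtain B where B: "B \<in> bases_in W" "y \<in> half_open_cone B (N B)" by (auto simp: regular_bases_def)
      have "(\<Sum>b\<in>B. representation B y b *\<^sub>R b) \<in> convex_cone hull B"
        using B(2) unfolding convex_cone_hull_finite[OF bases_in_finite[OF B(1)]]
        by (auto simp: half_open_cone_def)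
      then show "y \<in> convex_cone hull W"
        using hull_mono[OF bases_in_subset[OF B(1)]] sum_representation_basis[OF B(1)] by auto
    qed
  qed
qed

section \<open>Lattice points of half-open simplicial cones\<close>

definition int_points :: "'a::euclidean_space set" where
  "int_points = {x. \<forall>b\<in>Basis. x \<bullet> b \<in> \<int>}"

lemma int_points_add: "x \<in> int_points \<Longrightarrow> y \<in> int_points \<Longrightarrow> x + y \<in> int_points"
  and int_points_diff: "x \<in> int_points \<Longrightarrow> y \<in> int_points \<Longrightarrow> x - y \<in> int_points"
  and int_points_scale: "k \<in> \<int> \<Longrightarrow> x \<in> int_points \<Longrightarrow> k *\<^sub>R x \<in> int_points"
  by (auto simp: int_points_def inner_add_left inner_diff_left)

text \<open>A bound on the norm bounds each coordinate, which leaves finitely many integer coordinate vectors.\<close>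

lemma finite_int_points_bounded:
  assumes "\<And>x :: 'a::euclidean_space. x \<in> S \<Longrightarrow> norm x \<le> M"
  shows "finite (S \<inter> int_points)"
proof (rule finite_subset)
  let ?F = "Basis \<rightarrow>\<^sub>E {-\<lceil>M\<rceil>..\<lceil>M\<rceil>} :: ('a \<Rightarrow> int) set"
  show "finite ((\<lambda>f. \<Sum>b\<in>Basis. of_int (f b) *\<^sub>R b :: 'a) ` ?F)"
    by (intro finite_imageI finite_PiE) auto
  show "S \<inter> int_points \<subseteq> (\<lambda>f. \<Sum>b\<in>Basis. of_int (f b) *\<^sub>R b) ` ?F"
  proof (rule subsetI, elim IntE)
    fix x assume x: "x \<in> S" "x \<in> int_points"
    have "\<lfloor>x \<bullet> b\<rfloor> \<in> {-\<lceil>M\<rceil>..\<lceil>M\<rceil>}" if b: "b \<in> Basis" for b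
    proof -
      have "\<bar>x \<bullet> b\<bar> \<le> M" using Basis_le_norm[OF b] assms[OF x(1)] order_trans by blast
      moreover have "of_int \<lfloor>x \<bullet> b\<rfloor> = x \<bullet> b" using x(2) b by (auto simp: int_points_def)
      ultimately show ?thesis by (auto simp: le_floor_iff) linarith+
    qed
    moreover have "x = (\<Sum>b\<in>Basis. of_int \<lfloor>x \<bullet> b\<rfloor> *\<^sub>R b)"
    proof -
      have "(\<Sum>b\<in>Basis. of_int \<lfloor>x \<bullet> b\<rfloor> *\<^sub>R b) = (\<Sum>b\<in>Basis. (x \<bullet> b) *\<^sub>R b)"
        using x(2) by (intro sum.cong) (auto simp: int_points_def)
      then show ?thesis by (simp add: euclidean_representation)
    qed
    ultimately show "x \<in> (\<lambda>f. \<Sum>b\<in>Basis. of_int (f b) *\<^sub>R b) ` ?F"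
      by (intro image_eqI[of _ _ "restrict (\<lambda>b. \<lfloor>x \<bullet> b\<rfloor>) Basis"]) auto
  qed
qed

text \<open>The lattice points at height \<open>n\<close> whose coordinates along \<open>S\<close> are unrestricted in the half-open cone, while
the others stay within one period, \<open>[0, 1)\<close> or \<open>(0, 1]\<close> according to the removed facets. The set \<open>S\<close>
interpolates between the half-open box for \<open>S = {}\<close> and the half-open cone for \<open>S = B\<close>.\<close>

definition cone_slice :: "('a::euclidean_space \<Rightarrow> real) \<Rightarrow> 'a set \<Rightarrow> 'a set \<Rightarrow> 'a set \<Rightarrow> nat \<Rightarrow> 'a set" where
  "cone_slice ht B N S n = {z \<in> half_open_cone B N \<inter> int_points. ht z = real n \<and>
     (\<forall>b\<in>B - S. representation B z b \<le> 1 \<and> (b \<notin> N \<longrightarrow> representation B z b < 1))}"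

lemma height_eq_sum:
  assumes B: "B \<in> bases_in W" and ht: "linear ht" "\<And>b. b \<in> B \<Longrightarrow> ht b = real m"
  shows "ht z = real m * (\<Sum>b\<in>B. representation B z b)"
proof -
  have "ht z = ht (\<Sum>b\<in>B. representation B z b *\<^sub>R b)" by (simp add: sum_representation_basis[OF B])
  also have "\<dots> = (\<Sum>b\<in>B. representation B z b * real m)"
    by (simp add: linear_sum[OF ht(1)] linear_scale[OF ht(1)] ht(2))
  finally show ?thesis by (simp add: sum_distrib_left mult.commute)
qed

text \<open>The coordinates are nonnegative and their sum is determined by the height, so they are bounded.\<close>

lemma finite_cone_slice:
  assumes B: "B \<in> bases_in W" and ht: "linear ht" "\<And>b. b \<in> B \<Longrightarrow> ht b = real m" and "m > 0"
  shows "finite (cone_slice ht B N S n)"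
proof -
  note finB = bases_in_finite[OF B]
  have "norm z \<le> (\<Sum>b\<in>B. real n * norm b)" if z: "z \<in> half_open_cone B N" "ht z = real n" for z
  proof -
    let ?c = "representation B z"
    have c: "0 \<le> ?c b" if "b \<in> B" for b using z that by (auto simp: half_open_cone_def)
    have c1: "?c b \<le> real n" if "b \<in> B" for b
    proof -
      have "?c b \<le> (\<Sum>b\<in>B. ?c b)" using that c finB by (intro member_le_sum) auto
      also have "\<dots> \<le> real m * (\<Sum>b\<in>B. ?c b)"
        using \<open>m > 0\<close> sum_nonneg[of B ?c] c mult_right_mono[of 1 "real m" "sum ?c B"] by simp
      finally show ?thesis using height_eq_sum[OF B ht] z(2) by simp
    qed
    have "norm z = norm (\<Sum>b\<in>B. ?c b *\<^sub>R b)" by (simp add: sum_representation_basis[OF B])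
    also have "\<dots> \<le> (\<Sum>b\<in>B. real n * norm b)"
      using c c1 by (intro order_trans[OF norm_sum] sum_mono) (auto intro: mult_right_mono)
    finally show ?thesis .
  qed
  then have "finite ({z \<in> half_open_cone B N. ht z = real n} \<inter> int_points)"
    by (intro finite_int_points_bounded) auto
  then show ?thesis by (rule rev_finite_subset) (auto simp: cone_slice_def)
qed

text \<open>Once the coordinate along \<open>u\<close> is free, either it lies within one period, or subtracting \<open>u\<close> leads back to a
point of the same kind, \<open>m\<close> levels lower.\<close>

lemma card_cone_slice_insert:
  assumes B: "B \<in> bases_in W" and ht: "linear ht" "\<And>b. b \<in> B \<Longrightarrow> ht b = real m" and "m > 0"
    and int: "B \<subseteq> int_points" and u: "u \<in> B" "u \<notin> S"
  shows "card (cone_slice ht B N (insert u S) n) = card (cone_slice ht B N S n) +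
           (if m \<le> n then card (cone_slice ht B N (insert u S) (n - m)) else 0)"
proof -
  let ?R = "representation B"
  let ?A = "cone_slice ht B N (insert u S)"
  let ?D = "{z \<in> ?A n. 1 \<le> ?R z u \<and> (u \<in> N \<longrightarrow> 1 < ?R z u)}"
  have fin: "finite (cone_slice ht B N S n)" for S n using finite_cone_slice[OF B ht \<open>m > 0\<close>] .
  have Ru: "?R (z - u) b = ?R z b - (if b = u then 1 else 0)" "?R (z + u) b = ?R z b + (if b = u then 1 else 0)" for z b
    by (simp_all add: representation_basis_diff[OF B] representation_basis_add[OF B] representation_basis_member[OF B u(1)])
  have htu: "ht (z - u) = ht z - real m" "ht (z + u) = ht z + real m" for z
    using ht(2)[OF u(1)] by (simp_all add: linear_diff[OF ht(1)] linear_add[OF ht(1)])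
  have uint: "u \<in> int_points" using int u by auto
  have split: "?A n = cone_slice ht B N S n \<union> ?D"
    using u by (auto simp: cone_slice_def half_open_cone_def not_less not_le)
  have disj: "cone_slice ht B N S n \<inter> ?D = {}"
    using u by (fastforce simp: cone_slice_def half_open_cone_def)
  have "card (?A n) = card (cone_slice ht B N S n) + card ?D"
    by (subst split) (rule card_Un_disjoint[OF fin _ disj], simp add: fin)
  moreover have "card ?D = (if m \<le> n then card (?A (n - m)) else 0)"
  proof (cases "m \<le> n")
    case True
    have "bij_betw (\<lambda>z. z + u) (?A (n - m)) ?D"
    proof (rule bij_betw_byWitness[where f' = "\<lambda>z. z - u"])
      show "(\<lambda>z. z + u) ` ?A (n - m) \<subseteq> ?D"
      proof (rule image_subsetI)
        fix z assume z: "z \<in> ?A (n - m)"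
        then have "0 \<le> ?R z u" using u(1) by (auto simp: cone_slice_def half_open_cone_def)
        then show "z + u \<in> ?D"
          using z True uint u(1) by (auto simp: cone_slice_def half_open_cone_def Ru htu int_points_add)
      qed
      show "(\<lambda>z. z - u) ` ?D \<subseteq> ?A (n - m)"
        using True uint by (auto simp: cone_slice_def half_open_cone_def Ru htu int_points_diff)
    qed auto
    then show ?thesis using True by (simp add: bij_betw_same_card)
  next
    case False
    have "?D = {}"
    proof (rule ccontr)
      assume "?D \<noteq> {}"
      then obtain z where z: "z \<in> half_open_cone B N" "1 \<le> ?R z u" "ht z = real n" by (auto simp: cone_slice_def)
      have "?R z u \<le> (\<Sum>b\<in>B. ?R z b)"
        using z(1) u bases_in_finite[OF B] by (intro member_le_sum) (auto simp: half_open_cone_def)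
      then have "real m * 1 \<le> real m * (\<Sum>b\<in>B. ?R z b)" using z(2) by (intro mult_left_mono) auto
      also have "\<dots> = real n" using height_eq_sum[OF B ht, of z] z(3) by simp
      finally show False using False by simp
    qed
    then have "card ?D = 0" by (simp only: card.empty)
    then show ?thesis using False by (simp only: if_False)
  qed
  ultimately show ?thesis by simp
qed

text \<open>Each freed coordinate contributes one geometric series, hence one factor \<open>1 - X ^ m\<close>.\<close>

lemma cone_slice_series:
  assumes B: "B \<in> bases_in W" and ht: "linear ht" "\<And>b. b \<in> B \<Longrightarrow> ht b = real m" and "m > 0"
    and int: "B \<subseteq> int_points"
  shows "Abs_fps (\<lambda>n. of_nat (card (cone_slice ht B N B n))) * (1 - fps_X ^ m) ^ card B =
         Abs_fps (\<lambda>n. of_nat (card (cone_slice ht B N {} n)) :: rat)"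
proof -
  define G :: "'a set \<Rightarrow> rat fps" where "G S = Abs_fps (\<lambda>n. of_nat (card (cone_slice ht B N S n)))" for S
  have "G S * (1 - fps_X ^ m) ^ card S = G {}" if "S \<subseteq> B" for S
    using finite_subset[OF that bases_in_finite[OF B]] that
  proof (induction S rule: finite_induct)
    case (insert u S)
    have step: "G (insert u S) * (1 - fps_X ^ m) = G S"
    proof (rule fps_ext)
      fix n
      have "fps_nth (G (insert u S) * (1 - fps_X ^ m)) n =
          fps_nth (G (insert u S)) n - (if n < m then 0 else fps_nth (G (insert u S)) (n - m))"
        by (simp add: right_diff_distrib fps_X_power_mult_right_nth)
      also have "\<dots> = fps_nth (G S) n"
        using card_cone_slice_insert[OF B ht \<open>m > 0\<close> int, of u S N n] insert by (simp add: G_def)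
      finally show "fps_nth (G (insert u S) * (1 - fps_X ^ m)) n = fps_nth (G S) n" .
    qed
    have "card (insert u S) = Suc (card S)" using insert.hyps by simp
    then have "G (insert u S) * (1 - fps_X ^ m) ^ card (insert u S) =
        (G (insert u S) * (1 - fps_X ^ m)) * (1 - fps_X ^ m) ^ card S"
      by (simp only: power_Suc mult.assoc)
    also have "\<dots> = G {}" unfolding step using insert by simp
    finally show ?case .
  qed simp
  then show ?thesis by (simp add: G_def)
qed

text \<open>The box lies below the sum of its generators; this makes the numerator a polynomial.\<close>

lemma cone_slice_box_bounded:
  assumes B: "B \<in> bases_in W" and ht: "linear ht" "\<And>b. b \<in> B \<Longrightarrow> ht b = real m"
    and n: "m * card B < n"
  shows "cone_slice ht B N {} n = {}"
proof (rule ccontr)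
  assume "cone_slice ht B N {} n \<noteq> {}"
  then obtain z where z: "ht z = real n" "\<And>b. b \<in> B \<Longrightarrow> representation B z b \<le> 1"
    by (auto simp: cone_slice_def)
  have "(\<Sum>b\<in>B. representation B z b) \<le> real (card B)"
    using sum_mono[of B "representation B z" "\<lambda>_. 1"] z(2) by simp
  then have "real n \<le> real m * real (card B)"
    using height_eq_sum[OF B ht, of z] z(1) by (simp add: mult_left_mono)
  then show False using n by (metis not_le of_nat_le_iff of_nat_mult)
qed

text \<open>The numerator counts, by height, the lattice points of the half-open boxes of all cones in the decomposition.\<close>

theorem cone_series_numerator:
  fixes W :: "'a::euclidean_space set"
  assumes fin: "finite W" and int: "W \<subseteq> int_points" and span: "span W = UNIV"
    and ht: "linear ht" "\<And>v. v \<in> W \<Longrightarrow> ht v = real m" and m: "m > 0"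
  shows "\<exists>h :: int poly. (\<forall>k. 0 \<le> coeff h k) \<and>
    Abs_fps (\<lambda>n. of_nat (card {z \<in> convex_cone hull W \<inter> int_points. ht z = real n})) * (1 - fps_X ^ m) ^ DIM('a) =
     (fps_of_poly (map_poly of_int h) :: rat fps)"
proof -
  obtain T N where T: "T \<subseteq> bases_in W" "convex_cone hull W = (\<Union>B\<in>T. half_open_cone B (N B))"
    "disjoint_family_on (\<lambda>B. half_open_cone B (N B)) T"
    by (rule half_open_decomposition[OF fin span ht(1)]) (use ht m in auto)
  have finT: "finite T" using T(1) finite_bases_in[OF fin] finite_subset by blast
  have TB: "B \<in> bases_in W" "\<And>b. b \<in> B \<Longrightarrow> ht b = real m" "B \<subseteq> int_points" "card B = DIM('a)" if "B \<in> T" for B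
    using T(1) that ht(2) int bases_in_subset[of B W] bases_in_card[of B W] by auto
  define f where "f n = (\<Sum>B\<in>T. card (cone_slice ht B (N B) {} n))" for n
  define M where "M = m * DIM('a)"
  define h where "h = (\<Sum>n\<le>M. monom (int (f n)) n)"
  have f0: "f n = 0" if "M < n" for n
    using cone_slice_box_bounded[OF TB(1) ht(1) TB(2), of _ _ n] TB(4) that by (simp add: f_def M_def)
  have h: "coeff h n = int (f n)" for n
    using f0[of n] by (auto simp: h_def coeff_sum not_le)
  have split: "card {z \<in> convex_cone hull W \<inter> int_points. ht z = real n} = (\<Sum>B\<in>T. card (cone_slice ht B (N B) B n))" for n
  proof -
    have "{z \<in> convex_cone hull W \<inter> int_points. ht z = real n} = (\<Union>B\<in>T. cone_slice ht B (N B) B n)"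
      by (auto simp: T(2) cone_slice_def)
    moreover have "cone_slice ht B (N B) B n \<inter> cone_slice ht C (N C) C n = {}" if "B \<in> T" "C \<in> T" "B \<noteq> C" for B C
      using disjoint_family_onD[OF T(3) that] by (auto simp: cone_slice_def)
    ultimately show ?thesis
      using card_UN_disjoint[OF finT, of "\<lambda>B. cone_slice ht B (N B) B n"] finite_cone_slice[OF TB(1) ht(1) TB(2) m] by simp
  qed
  have "Abs_fps (\<lambda>n. of_nat (card {z \<in> convex_cone hull W \<inter> int_points. ht z = real n})) =
      (\<Sum>B\<in>T. Abs_fps (\<lambda>n. of_nat (card (cone_slice ht B (N B) B n))) :: rat fps)"
    by (rule fps_ext) (simp only: split fps_sum_nth fps_nth_Abs_fps of_nat_sum)
  then have "Abs_fps (\<lambda>n. of_nat (card {z \<in> convex_cone hull W \<inter> int_points. ht z = real n})) * (1 - fps_X ^ m) ^ DIM('a) =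
      (\<Sum>B\<in>T. Abs_fps (\<lambda>n. of_nat (card (cone_slice ht B (N B) {} n))) :: rat fps)"
    using cone_slice_series[OF TB(1) ht(1) TB(2) m TB(3)] TB(4)
    by (simp add: sum_distrib_right)
  also have "\<dots> = fps_of_poly (map_poly of_int h)"
    by (rule fps_ext) (simp add: fps_sum_nth coeff_map_poly h f_def)
  finally show ?thesis by (intro exI[of _ h] conjI) (simp_all add: h)
qed

section \<open>Integral halfspace descriptions\<close>

lemma int_points_inner: "x \<in> int_points \<Longrightarrow> y \<in> int_points \<Longrightarrow> x \<bullet> y \<in> \<int>"
  by (subst euclidean_inner) (auto simp: int_points_def)

text \<open>Fourier--Motzkin elimination of the single unknown \<open>s\<close>. Inequalities with \<open>a \<bullet> v > 0\<close> bound \<open>s\<close> from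
below, those with \<open>a \<bullet> v < 0\<close> from above; the condition is that each lower bound, including \<open>0\<close>, is at
most each upper bound. The resulting inequalities are integral if the given ones and \<open>v\<close> are.\<close>

lemma ray_elimination:
  fixes A :: "'a::real_inner set"
  assumes fin: "finite A"
  shows "(\<exists>s\<ge>0. \<forall>a\<in>A. a \<bullet> y \<le> s * (a \<bullet> v)) \<longleftrightarrow>
    (\<forall>a\<in>A. a \<bullet> v \<le> 0 \<longrightarrow> a \<bullet> y \<le> 0) \<and>
    (\<forall>a\<in>A. \<forall>b\<in>A. 0 < a \<bullet> v \<longrightarrow> b \<bullet> v < 0 \<longrightarrow> ((a \<bullet> v) *\<^sub>R b - (b \<bullet> v) *\<^sub>R a) \<bullet> y \<le> 0)"
    (is "?l \<longleftrightarrow> ?r1 \<and> ?r2")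
proof
  assume ?l
  then obtain s where s: "0 \<le> s" "\<And>a. a \<in> A \<Longrightarrow> a \<bullet> y \<le> s * (a \<bullet> v)" by blast
  have ?r1
  proof (intro ballI impI)
    fix a assume "a \<in> A" "a \<bullet> v \<le> 0"
    then show "a \<bullet> y \<le> 0" using s(2)[of a] mult_nonneg_nonpos[OF s(1), of "a \<bullet> v"] by linarith
  qed
  moreover have ?r2
  proof (intro ballI impI)
    fix a b assume ab: "a \<in> A" "b \<in> A" "0 < a \<bullet> v" "b \<bullet> v < 0"
    have "(a \<bullet> v) * (b \<bullet> y) \<le> (a \<bullet> v) * (s * (b \<bullet> v))" using s(2)[OF ab(2)] ab(3) by (intro mult_left_mono) auto
    moreover have "(b \<bullet> v) * (s * (a \<bullet> v)) \<le> (b \<bullet> v) * (a \<bullet> y)" using s(2)[OF ab(1)] ab(4) by (intro mult_left_mono_neg) auto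
    ultimately show "((a \<bullet> v) *\<^sub>R b - (b \<bullet> v) *\<^sub>R a) \<bullet> y \<le> 0"
      by (simp add: inner_diff_left algebra_simps)
  qed
  ultimately show "?r1 \<and> ?r2" ..
next
  assume r: "?r1 \<and> ?r2"
  define X where "X = insert 0 ((\<lambda>a. a \<bullet> y / (a \<bullet> v)) ` {a \<in> A. 0 < a \<bullet> v})"
  have X: "finite X" "X \<noteq> {}" using fin by (auto simp: X_def)
  define s where "s = Max X"
  have sX: "s \<in> X" "\<And>x. x \<in> X \<Longrightarrow> x \<le> s" using X by (auto simp: s_def)
  have "a \<bullet> y \<le> s * (a \<bullet> v)" if a: "a \<in> A" for a
  proof -
    consider "a \<bullet> v = 0" | "0 < a \<bullet> v" | "a \<bullet> v < 0" by linarith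
    then show ?thesis
    proof cases
      case 1
      then show ?thesis using r a by auto
    next
      case 2
      then have "a \<bullet> y / (a \<bullet> v) \<le> s" using a by (intro sX) (auto simp: X_def)
      then show ?thesis using 2 by (simp add: pos_divide_le_eq)
    next
      case 3
      show ?thesis
      proof (cases "s = 0")
        case True
        then show ?thesis using r 3 a by auto
      next
        case False
        then obtain b where b: "b \<in> A" "0 < b \<bullet> v" "s = b \<bullet> y / (b \<bullet> v)" using sX(1) by (auto simp: X_def)
        have "((b \<bullet> v) *\<^sub>R a - (a \<bullet> v) *\<^sub>R b) \<bullet> y \<le> 0" using r a b 3 by blast
        moreover have "b \<bullet> y = s * (b \<bullet> v)" using b by simp
        ultimately have "(b \<bullet> v) * (a \<bullet> y) \<le> (b \<bullet> v) * (s * (a \<bullet> v))"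
          by (simp add: inner_diff_left algebra_simps)
        then show ?thesis using b(2) by simp
      qed
    qed
  qed
  moreover have "0 \<le> s" by (rule sX) (simp add: X_def)
  ultimately show ?l by blast
qed

text \<open>A point \<open>y\<close> lies in the cone of \<open>insert v S\<close> iff \<open>y - s v\<close> lies in the cone of \<open>S\<close> for some
\<open>s \<ge> 0\<close>, so the description of the larger cone arises by eliminating \<open>s\<close>.\<close>

theorem integer_cone_halfspaces:
  fixes S :: "'a::euclidean_space set"
  assumes "finite S" "S \<subseteq> int_points"
  obtains A where "finite A" "A \<subseteq> int_points" "convex_cone hull S = {y. \<forall>a\<in>A. a \<bullet> y \<le> 0}"
proof -
  have "\<exists>A. finite A \<and> A \<subseteq> int_points \<and> convex_cone hull S = {y. \<forall>a\<in>A. a \<bullet> y \<le> 0}"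
    using assms
  proof (induction S rule: finite_induct)
    case empty
    let ?A = "Basis \<union> uminus ` Basis :: 'a set"
    have "(\<forall>a\<in>?A. a \<bullet> y \<le> 0) \<longleftrightarrow> y = 0" for y
      by (auto simp: ball_Un intro!: euclidean_eqI[of y 0]) (metis inner_commute order_antisym)
    moreover have "?A \<subseteq> int_points" by (auto simp: int_points_def inner_Basis)
    ultimately show ?case by (intro exI[of _ ?A]) auto
  next
    case (insert v S)
    then obtain A where A: "finite A" "A \<subseteq> int_points" "convex_cone hull S = {y. \<forall>a\<in>A. a \<bullet> y \<le> 0}" by auto
    define C where "C = {a \<in> A. a \<bullet> v \<le> 0} \<union>
      (\<lambda>(a, b). (a \<bullet> v) *\<^sub>R b - (b \<bullet> v) *\<^sub>R a) ` ({a \<in> A. 0 < a \<bullet> v} \<times> {b \<in> A. b \<bullet> v < 0})"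
    have "finite C" using A(1) by (auto simp: C_def)
    moreover have "C \<subseteq> int_points"
    proof -
      have "v \<in> int_points" using insert.prems by auto
      then show ?thesis using A(2) unfolding C_def
        by (auto intro!: int_points_diff int_points_scale int_points_inner)
    qed
    moreover have "y \<in> convex_cone hull (insert v S) \<longleftrightarrow> (\<forall>a\<in>C. a \<bullet> y \<le> 0)" for y
    proof -
      have "y \<in> convex_cone hull (insert v S) \<longleftrightarrow> (\<exists>s\<ge>0. y - s *\<^sub>R v \<in> convex_cone hull S)"
      proof
        assume "y \<in> convex_cone hull (insert v S)"
        then obtain c where "\<forall>u\<in>insert v S. 0 \<le> c u" "y = (\<Sum>u\<in>insert v S. c u *\<^sub>R u)"
          using insert.hyps(1) by (auto simp: convex_cone_hull_finite)
        then show "\<exists>s\<ge>0. y - s *\<^sub>R v \<in> convex_cone hull S"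
          using insert.hyps by (intro exI[of _ "c v"]) (auto simp: convex_cone_hull_finite)
      next
        assume "\<exists>s\<ge>0. y - s *\<^sub>R v \<in> convex_cone hull S"
        then obtain s where s: "0 \<le> s" "y - s *\<^sub>R v \<in> convex_cone hull S" by blast
        have "y - s *\<^sub>R v \<in> convex_cone hull (insert v S)"
          using s(2) hull_mono[of S "insert v S"] by blast
        moreover have "s *\<^sub>R v \<in> convex_cone hull (insert v S)"
          using s(1) by (intro convex_cone_hull_mul hull_inc) auto
        ultimately show "y \<in> convex_cone hull (insert v S)"
          using convex_cone_hull_add by fastforce
      qed
      also have "\<dots> \<longleftrightarrow> (\<exists>s\<ge>0. \<forall>a\<in>A. a \<bullet> y \<le> s * (a \<bullet> v))"
        by (simp add: A(3) inner_diff_right)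
      also have "\<dots> \<longleftrightarrow> (\<forall>a\<in>C. a \<bullet> y \<le> 0)"
        unfolding ray_elimination[OF A(1)] C_def by (auto simp: ball_Un)
      finally show ?thesis .
    qed
    ultimately show ?case by (intro exI[of _ C]) auto
  qed
  then show thesis using that by blast
qed

section \<open>The cone over a polytope\<close>

lemma cone_over_convex_hull:
  fixes V :: "'a::euclidean_space set"
  assumes "V \<noteq> {}" "0 < m"
  shows "(x, t) \<in> convex_cone hull (V \<times> {m}) \<longleftrightarrow> 0 \<le> t \<and> x \<in> (\<lambda>y. (t / m) *\<^sub>R y) ` (convex hull V)"
proof -
  have "convex_cone hull (V \<times> {m}) = conic hull ((convex hull V) \<times> {m})"
    using assms by (simp add: convex_cone_hull_separate_nonempty convex_hull_Times)
  also have "(x, t) \<in> \<dots> \<longleftrightarrow> (\<exists>c\<ge>0. \<exists>p\<in>convex hull V. x = c *\<^sub>R p \<and> t = c * m)"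
    by (auto simp: conic_hull_explicit)
  also have "\<dots> \<longleftrightarrow> 0 \<le> t \<and> x \<in> (\<lambda>y. (t / m) *\<^sub>R y) ` (convex hull V)"
  proof
    assume "\<exists>c\<ge>0. \<exists>p\<in>convex hull V. x = c *\<^sub>R p \<and> t = c * m"
    then show "0 \<le> t \<and> x \<in> (\<lambda>y. (t / m) *\<^sub>R y) ` (convex hull V)" using assms(2) by auto
  next
    assume "0 \<le> t \<and> x \<in> (\<lambda>y. (t / m) *\<^sub>R y) ` (convex hull V)"
    then show "\<exists>c\<ge>0. \<exists>p\<in>convex hull V. x = c *\<^sub>R p \<and> t = c * m"
      using assms(2) by (intro exI[of _ "t / m"]) auto
  qed
  finally show ?thesis .
qed

lemma lattice_lift_int_point:
  fixes x :: "real ^ 'd" and t :: real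
  shows "(x, t) \<in> int_points \<longleftrightarrow> lattice_point x \<and> t \<in> \<int>"
proof -
  have "(x, t) \<in> int_points \<longleftrightarrow> (\<forall>b\<in>Basis. x \<bullet> b \<in> \<int>) \<and> t \<in> \<int>"
    by (auto simp: int_points_def Basis_prod_def ball_Un)
  also have "(\<forall>b\<in>Basis. x \<bullet> b \<in> \<int>) \<longleftrightarrow> lattice_point x"
    by (auto simp: lattice_point_def Basis_vec_def inner_axis)
  finally show ?thesis .
qed

section \<open>Positivity of the codenominator\<close>

lemma common_denominator:
  fixes Q :: "real set"
  assumes "finite Q" "Q \<subseteq> \<rat>"
  shows "\<exists>k::nat>0. \<forall>q\<in>Q. real k * q \<in> \<int>"
  using assms
proof (induction Q rule: finite_induct)
  case (insert q Q)
  then obtain k where k: "k > 0" "\<forall>q\<in>Q. real k * q \<in> \<int>" by auto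
  obtain i :: int and j :: nat where ij: "j > 0" "q = of_int i / real j"
    using insert.prems Rats_cases'[of q] by (metis insert_subset of_nat_0_less_iff of_nat_nat less_imp_le zero_less_nat_eq)
  have "real (k * j) * p \<in> \<int>" if "p \<in> insert q Q" for p
  proof (cases "p = q")
    case True
    then have "real (k * j) * p = of_int (int k * i)" using ij by simp
    then show ?thesis by (metis Ints_of_int)
  next
    case False
    then have "real k * p \<in> \<int>" using that k(2) by auto
    then have "real j * (real k * p) \<in> \<int>" by (rule Ints_mult[OF Ints_of_nat])
    then show ?thesis by (simp add: ac_simps)
  qed
  then show ?case using k(1) ij(1) by (intro exI[of _ "k * j"]) auto
qed (auto intro: exI[of _ 1])

lemma rational_polytope_clear_denominators:
  assumes "rational_polytope P"
  obtains k :: nat where "k > 0" "lattice_polytope ((\<lambda>x. real k *\<^sub>R x) ` P)"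
proof -
  obtain V where V: "finite V" "\<And>v. v \<in> V \<Longrightarrow> rational_point v" "P = convex hull V"
    using assms by (auto simp: rational_polytope_def)
  have "(\<Union>v\<in>V. range (\<lambda>i. v $ i)) \<subseteq> \<rat>" using V(2) by (auto simp: rational_point_def)
  then obtain k :: nat where k: "k > 0" "\<And>v i. v \<in> V \<Longrightarrow> real k * v $ i \<in> \<int>"
    using common_denominator[of "\<Union>v\<in>V. range (\<lambda>i. v $ i)"] V(1) by auto
  have "(\<lambda>x. real k *\<^sub>R x) ` P = convex hull ((\<lambda>x. real k *\<^sub>R x) ` V)"
    by (simp add: V(3) convex_hull_scaling)
  then have "lattice_polytope ((\<lambda>x. real k *\<^sub>R x) ` P)"
    unfolding lattice_polytope_def using V(1) k(2)
    by (intro exI[of _ "(\<lambda>x. real k *\<^sub>R x) ` V"]) (auto simp: lattice_point_def)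
  then show thesis using that k(1) by blast
qed

text \<open>A multiple \<open>k P\<close> is a lattice polytope, and \<open>P\<close> is the section at height \<open>1\<close> of the integral cone over
\<open>k P\<close> placed at height \<open>k\<close>. Setting the last coordinate to \<open>1\<close> in the inequalities of that cone gives
those of \<open>P\<close>.\<close>

lemma rational_polytope_solution_set:
  fixes P :: "(real ^ 'd) set"
  assumes "rational_polytope P" "P \<noteq> {}"
  obtains H where "finite H" "P = solution_set H"
proof -
  obtain k where k: "k > 0" "lattice_polytope ((\<lambda>x. real k *\<^sub>R x) ` P)"
    using rational_polytope_clear_denominators[OF assms(1)] .
  then obtain V where V: "finite V" "\<And>v. v \<in> V \<Longrightarrow> lattice_point v" "(\<lambda>x. real k *\<^sub>R x) ` P = convex hull V"
    by (auto simp: lattice_polytope_def)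
  have "V \<noteq> {}" using V(3) assms(2) by auto
  have P: "P = (\<lambda>y. (1 / real k) *\<^sub>R y) ` (convex hull V)"
    unfolding V(3)[symmetric] using k(1) by (auto simp: image_image)
  have W: "finite (V \<times> {real k})" "V \<times> {real k} \<subseteq> int_points"
    using V(1,2) by (auto simp: lattice_lift_int_point)
  obtain A where A: "finite A" "A \<subseteq> int_points" "convex_cone hull (V \<times> {real k}) = {y. \<forall>a\<in>A. a \<bullet> y \<le> 0}"
    using integer_cone_halfspaces[OF W] .
  define row :: "(real ^ 'd) \<times> real \<Rightarrow> (int ^ 'd) \<times> int" where "row = (\<lambda>(a, b). (\<chi> i. \<lfloor>a $ i\<rfloor>, - \<lfloor>b\<rfloor>))"
  have "x \<in> P \<longleftrightarrow> x \<in> solution_set (row ` A)" for x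
  proof -
    have "x \<in> P \<longleftrightarrow> (x, 1) \<in> convex_cone hull (V \<times> {real k})"
      using cone_over_convex_hull[OF \<open>V \<noteq> {}\<close>, of "real k" x 1] k(1) P by simp
    also have "\<dots> \<longleftrightarrow> (\<forall>(a, b)\<in>A. a \<bullet> x + b \<le> 0)"
      by (auto simp: A(3) inner_Pair)
    also have "\<dots> \<longleftrightarrow> (\<forall>(a, b)\<in>A. (\<Sum>i\<in>UNIV. of_int \<lfloor>a $ i\<rfloor> * x $ i) \<le> of_int (- \<lfloor>b\<rfloor>))"
    proof (intro ball_cong refl, clarify)
      fix a b assume "(a, b) \<in> A"
      then have "(a, b) \<in> int_points" using A(2) by blast
      then have "lattice_point a" "b \<in> \<int>"
        by (simp_all add: lattice_lift_int_point)
      then have sum: "(\<Sum>i\<in>UNIV. of_int \<lfloor>a $ i\<rfloor> * x $ i) = a \<bullet> x"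
        and b: "b \<in> \<int>"
        by (simp_all add: inner_vec_def lattice_point_def)
      from b obtain n where "b = of_int n" by (rule Ints_cases)
      with sum show "a \<bullet> x + b \<le> 0 \<longleftrightarrow> (\<Sum>i\<in>UNIV. of_int \<lfloor>a $ i\<rfloor> * x $ i) \<le> of_int (- \<lfloor>b\<rfloor>)"
        by auto
    qed
    also have "\<dots> \<longleftrightarrow> x \<in> solution_set (row ` A)"
      by (auto simp: solution_set_def row_def)
    finally show ?thesis .
  qed
  then show thesis using that[of "row ` A"] A(1) by blast
qed

lemma primitive_row:
  fixes a :: "int ^ 'd" and b :: int
  assumes "(a, b) \<noteq> (0, 0)"
  obtains a' b' where "Gcd (insert b' (range (\<lambda>i. a' $ i))) = 1" "solution_set {(a', b')} = solution_set {(a, b)}"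
proof -
  define g where "g = Gcd (insert b (range (\<lambda>i. a $ i)))"
  have "g \<noteq> 0" using assms by (auto simp: g_def Gcd_0_iff vec_eq_iff)
  moreover have "0 \<le> g" by (simp add: g_def)
  ultimately have g: "0 < g" by simp
  have dvd: "g dvd b" "\<And>i. g dvd a $ i" by (auto simp: g_def simp del: Gcd_insert)
  define a' where "a' = (\<chi> i. a $ i div g)"
  define b' where "b' = b div g"
  have a': "a $ i = g * a' $ i" for i using dvd by (simp add: a'_def)
  have b': "b = g * b'" using dvd by (simp add: b'_def)
  have "insert b (range (\<lambda>i. a $ i)) = (*) g ` insert b' (range (\<lambda>i. a' $ i))"
    unfolding b' a' by auto
  then have "g = Gcd ((*) g ` insert b' (range (\<lambda>i. a' $ i)))"
    by (simp only: g_def)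
  also have "\<dots> = g * Gcd (insert b' (range (\<lambda>i. a' $ i)))"
    using g by (simp only: Gcd_mult) (simp add: abs_mult)
  finally have "Gcd (insert b' (range (\<lambda>i. a' $ i))) = 1" using g by simp
  moreover have "solution_set {(a', b')} = solution_set {(a, b)}"
  proof -
    have "(\<Sum>i\<in>UNIV. of_int (a $ i) * x $ i) = of_int g * (\<Sum>i\<in>UNIV. of_int (a' $ i) * x $ i)" for x :: "real ^ 'd"
      by (simp add: a' sum_distrib_left mult.assoc)
    then show ?thesis using g by (simp add: solution_set_def b')
  qed
  ultimately show thesis by (rule that)
qed

lemma solution_set_INT: "solution_set H = (\<Inter>h\<in>H. solution_set {h})"
  by (auto simp: solution_set_def)

text \<open>Trivial rows \<open>(0, 0)\<close> have no primitive multiple and are dropped. Among the primitive systems that describe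
\<open>P\<close>, one with the fewest rows is irredundant.\<close>

lemma irredundant_description_exists:
  fixes P :: "(real ^ 'd) set"
  assumes "rational_polytope P" "P \<noteq> {}"
  shows "\<exists>H. irredundant_description H P"
proof -
  let ?prim = "\<lambda>(a :: int ^ 'd, b). Gcd (insert b (range (\<lambda>i. a $ i))) = 1"
  define ok where "ok H \<longleftrightarrow> finite H \<and> P = solution_set H \<and> (\<forall>h\<in>H. ?prim h)" for H
  have "\<exists>H. ok H"
  proof -
    obtain H where H: "finite H" "P = solution_set H"
      using rational_polytope_solution_set[OF assms] .
    have "\<exists>h'. ?prim h' \<and> solution_set {h'} = solution_set {h}" if "h \<noteq> (0, 0)" for h
      using that by (cases h) (metis (mono_tags, lifting) case_prodI primitive_row)
    then obtain n where n: "\<And>h. h \<noteq> (0, 0) \<Longrightarrow> ?prim (n h) \<and> solution_set {n h} = solution_set {h}" by metis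
    have "solution_set {(0, 0)} = (UNIV :: (real ^ 'd) set)" by (simp add: solution_set_def)
    then have "solution_set H = (\<Inter>h\<in>H - {(0, 0)}. solution_set {h})"
      by (subst solution_set_INT) blast
    also have "\<dots> = (\<Inter>h\<in>H - {(0, 0)}. solution_set {n h})" using n by auto
    also have "\<dots> = solution_set (n ` (H - {(0, 0)}))"
      by (simp only: solution_set_INT[of "n ` (H - {(0, 0)})"] image_image)
    finally have "ok (n ` (H - {(0, 0)}))" using H n by (auto simp: ok_def)
    then show ?thesis ..
  qed
  then obtain H where H: "ok H" and min: "\<And>H'. ok H' \<Longrightarrow> card H \<le> card H'"
    using exists_least_iff[of "\<lambda>n. \<exists>H. ok H \<and> card H = n"] by (metis linorder_not_less)
  have "solution_set (H - {h}) \<noteq> P" if "h \<in> H" for h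
  proof
    assume "solution_set (H - {h}) = P"
    then have "ok (H - {h})" using H by (auto simp: ok_def)
    then have "card H \<le> card (H - {h})" by (rule min)
    moreover have "card (H - {h}) < card H" using H that by (intro card_Diff1_less) (auto simp: ok_def)
    ultimately show False by linarith
  qed
  then show ?thesis using H by (auto simp: irredundant_description_def ok_def)
qed

text \<open>A least common multiple of finitely many nonzero integers is nonzero. Finiteness of the chosen system is what the
existence of an irredundant description provides.\<close>

lemma codenominator_pos:
  assumes "rational_polytope P" "P \<noteq> {}"
  shows "codenominator P > 0"
proof -
  define H where "H = (SOME H. irredundant_description H P)"
  have "irredundant_description H P"
    unfolding H_def by (rule someI_ex) (rule irredundant_description_exists[OF assms])
  then have "finite (snd ` H - {0})" by (simp add: irredundant_description_def)
  then have "Lcm (snd ` H - {0}) \<noteq> 0" by (simp add: Lcm_0_iff)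
  then have "0 < Lcm (snd ` H - {0})" by (simp add: order.strict_iff_order)
  then show ?thesis by (simp add: codenominator_def H_def)
qed

section \<open>Ehrhart series of rational polytopes\<close>

text \<open>A vector \<open>(a, b)\<close> orthogonal to all lifted points would confine \<open>V\<close> to the hyperplane
\<open>a \<bullet> x = - b m\<close>.\<close>

lemma span_lifted_points:
  fixes V :: "(real ^ 'd) set"
  assumes full: "aff_dim V = int CARD('d)" and "m \<noteq> 0"
  shows "span (V \<times> {m :: real}) = UNIV"
proof (rule ccontr)
  assume "span (V \<times> {m}) \<noteq> UNIV"
  then obtain c where c: "c \<noteq> 0" "\<And>y. y \<in> span (V \<times> {m}) \<Longrightarrow> orthogonal c y"
    using orthogonal_to_subspace_exists[of "V \<times> {m}"] dim_eq_full[of "V \<times> {m}"] dim_subset_UNIV[of "V \<times> {m}"]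
    by (metis less_le orthogonal_to_subspace_exists)
  obtain a b where ab: "c = (a, b)" by (cases c)
  have orth: "a \<bullet> v = - (b * m)" if "v \<in> V" for v
    using c(2)[OF span_base, of "(v, m)"] that by (simp add: ab orthogonal_def inner_Pair)
  have "V \<noteq> {}" using full by auto
  have "a \<noteq> 0"
  proof
    assume "a = 0"
    then have "b = 0" using orth \<open>V \<noteq> {}\<close> \<open>m \<noteq> 0\<close> by auto
    then show False using c(1) \<open>a = 0\<close> by (simp add: ab zero_prod_def)
  qed
  moreover have "V \<subseteq> {x. a \<bullet> x = - (b * m)}" using orth by auto
  ultimately have "aff_dim V \<le> int CARD('d) - 1"
    using aff_dim_subset[of V "{x. a \<bullet> x = - (b * m)}"] aff_dim_hyperplane[of a "- (b * m)"] by simp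
  then show False using full by simp
qed

lemma lattice_polytope_slices_numerator:
  fixes V :: "(real ^ 'd) set"
  assumes fin: "finite V" and int: "\<And>v. v \<in> V \<Longrightarrow> lattice_point v"
    and full: "aff_dim V = int CARD('d)" and m: "m > 0"
  shows "\<exists>h :: int poly. (\<forall>k. 0 \<le> coeff h k) \<and>
    Abs_fps (\<lambda>n. of_nat (card {x \<in> (\<lambda>y. (real n / real m) *\<^sub>R y) ` (convex hull V). lattice_point x})) *
      (1 - fps_X ^ m) ^ (CARD('d) + 1) = (fps_of_poly (map_poly of_int h) :: rat fps)"
proof -
  let ?W = "V \<times> {real m}"
  have "V \<noteq> {}" using full by auto
  have W: "finite ?W" "?W \<subseteq> int_points" using fin int by (auto simp: lattice_lift_int_point)
  have span: "span ?W = UNIV" using span_lifted_points[OF full] m by simp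
  have ht: "linear (snd :: (real ^ 'd) \<times> real \<Rightarrow> real)" "\<And>v. v \<in> ?W \<Longrightarrow> snd v = real m"
    by (auto intro: linear_snd)
  have "card {x \<in> (\<lambda>y. (real n / real m) *\<^sub>R y) ` (convex hull V). lattice_point x} =
        card {z \<in> convex_cone hull ?W \<inter> int_points. snd z = real n}" for n
  proof (rule bij_betw_same_card[of "\<lambda>x. (x, real n)"])
    have mem: "(x, real n) \<in> convex_cone hull ?W \<inter> int_points \<longleftrightarrow>
        x \<in> (\<lambda>y. (real n / real m) *\<^sub>R y) ` (convex hull V) \<and> lattice_point x" for x
      using cone_over_convex_hull[OF \<open>V \<noteq> {}\<close>, of "real m" x "real n"] m by (simp add: lattice_lift_int_point)
    then have "{x \<in> (\<lambda>y. (real n / real m) *\<^sub>R y) ` (convex hull V). lattice_point x} =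
        {x. (x, real n) \<in> convex_cone hull ?W \<inter> int_points}" by (simp only:)
    moreover have "bij_betw (\<lambda>x. (x, real n)) {x. (x, real n) \<in> K} {z \<in> K. snd z = real n}"
      for K :: "((real ^ 'd) \<times> real) set"
      by (rule bij_betw_byWitness[where f' = fst]) auto
    ultimately show "bij_betw (\<lambda>x. (x, real n))
        {x \<in> (\<lambda>y. (real n / real m) *\<^sub>R y) ` (convex hull V). lattice_point x}
        {z \<in> convex_cone hull ?W \<inter> int_points. snd z = real n}"
      by (simp only:)
  qed
  then show ?thesis using cone_series_numerator[OF W span ht m] by (simp only: DIM_prod DIM_cart) simp
qed

text \<open>The constant term \<open>1\<close>, which is added separately in the definition, fits the general pattern: the dilate by
\<open>0\<close> is the origin.\<close>

lemma Ehr_ref_nth: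
  assumes "P \<noteq> {}"
  shows "fps_nth (Ehr_ref P) n =
    of_nat (card {x \<in> (\<lambda>y. (real n / real (2 * codenominator P)) *\<^sub>R y) ` P. lattice_point x})"
proof (cases "n = 0")
  case True
  have "{x \<in> (\<lambda>y. (0 :: real) *\<^sub>R y) ` P. lattice_point x} = {0}"
    using assms by (auto simp: lattice_point_def)
  then show ?thesis using True by (simp add: Ehr_ref_def)
next
  case False
  then show ?thesis by (simp add: Ehr_ref_def ehr_rat_def of_rat_divide of_rat_mult)
qed

theorem theorem12:
  fixes P :: "(real ^ 'd) set" and r m :: nat
  assumes "rational_polytope P" and "full_dimensional P"
    and "r = codenominator P"
    and "m > 0"
    and "lattice_polytope ((\<lambda>x. (real m / real (2 * r)) *\<^sub>R x) ` P)"
  shows "\<exists>h :: int poly. (\<forall>k. coeff h k \<ge> 0) \<and>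
           Ehr_ref P = fps_of_poly (map_poly of_int h) / (1 - fps_X ^ m) ^ (CARD('d) + 1)"
proof -
  have "P \<noteq> {}" using assms(2) by (auto simp: full_dimensional_def)
  then have "r > 0" unfolding assms(3) by (rule codenominator_pos[OF assms(1)])
  obtain V where V: "finite V" "\<And>v. v \<in> V \<Longrightarrow> lattice_point v"
    "(\<lambda>x. (real m / real (2 * r)) *\<^sub>R x) ` P = convex hull V"
    using assms(5) by (auto simp: lattice_polytope_def)
  have "aff_dim V = aff_dim ((\<lambda>x. (real m / real (2 * r)) *\<^sub>R x) ` P)"
    by (simp only: V(3) aff_dim_convex_hull)
  also have "\<dots> = aff_dim P"
    using \<open>r > 0\<close> \<open>m > 0\<close> by (intro aff_dim_injective_linear_image) (auto simp: inj_on_def linear_scale_self)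
  finally have full: "aff_dim V = int CARD('d)" using assms(2) by (simp add: full_dimensional_def)
  obtain h :: "int poly" where h: "\<forall>k. 0 \<le> coeff h k"
    "Abs_fps (\<lambda>n. of_nat (card {x \<in> (\<lambda>y. (real n / real m) *\<^sub>R y) ` (convex hull V). lattice_point x})) *
       (1 - fps_X ^ m) ^ (CARD('d) + 1) = (fps_of_poly (map_poly of_int h) :: rat fps)"
    using lattice_polytope_slices_numerator[OF V(1,2) full assms(4)] by blast
  have "(\<lambda>y. (real n / real m) *\<^sub>R y) ` (convex hull V) = (\<lambda>y. (real n / real (2 * r)) *\<^sub>R y) ` P" for n
    unfolding V(3)[symmetric] image_image using \<open>m > 0\<close> by (intro image_cong) auto
  then have "Ehr_ref P = Abs_fps (\<lambda>n. of_nat (card {x \<in> (\<lambda>y. (real n / real m) *\<^sub>R y) ` (convex hull V). lattice_point x}))"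
    by (intro fps_ext) (simp add: Ehr_ref_nth[OF \<open>P \<noteq> {}\<close>] assms(3))
  then have "Ehr_ref P * (1 - fps_X ^ m) ^ (CARD('d) + 1) = fps_of_poly (map_poly of_int h)"
    using h(2) by simp
  moreover have "(1 - fps_X ^ m :: rat fps) ^ (CARD('d) + 1) \<noteq> 0"
  proof -
    have "fps_nth (1 - fps_X ^ m :: rat fps) 0 = 1" using \<open>m > 0\<close> by simp
    then show ?thesis by (metis power_not_zero fps_zero_nth zero_neq_one)
  qed
  ultimately have "Ehr_ref P = fps_of_poly (map_poly of_int h) / (1 - fps_X ^ m) ^ (CARD('d) + 1)"
    by (metis nonzero_mult_div_cancel_right)
  then show ?thesis using h(1) by blast
qed

end
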